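(* Let $\mathcal{B}$ be a bornology with a closed base on a metric space $(X,d)$ with at least two points. Then $d(C(X),\tau_{\mathcal{B}}^s) = d(C(X),\tau_{\mathcal{B}}^{sw})$; and $d(C(X),\tau_{\mathcal{B}}) = d(C(X),\tau_{\mathcal{B}}^{w})$.
   Context: A bornology on $X$ is a family $\mathcal{B}$ of nonempty subsets of $X$ that covers $X$ and is an ideal, i.e. is closed under finite unions and under passing to nonempty subsets. A base for $\mathcal{B}$ is a subfamily $\mathcal{B}_0\subseteq\mathcal{B}$ such that every $B\in\mathcal{B}$ is contained in some $B'\in\mathcal{B}_0$; $\mathcal{B}$ has a closed base if it has a base all of whose members are closed in $(X,d)$. $C(X)$ is the set of continuous functions $X\to\mathbb{R}$, and $C^+(X)$ the set of continuous functions $X\to(0,\infty)$. For $A\subseteq X$ nonempty and $\delta>0$, $A^\delta=\bigcup_{x\in A}\{y\in X: d(x,y)<\delta\}$. Four topologies on $C(X)$ are induced by the uniformities with the following bases of entourages, $B$ ranging over $\mathcal{B}$: $\tau_{\mathcal{B}}$: $\{(f,g): |f(x)-g(x)|<\epsilon\ \forall x\in B\}$, $\epsilon>0$ real; $\tau_{\mathcal{B}}^{s}$: $\{(f,g): \exists\,\delta>0\ \forall x\in B^\delta,\ |f(x)-g(x)|<\epsilon\}$, $\epsilon>0$ real; $\tau_{\mathcal{B}}^{w}$: $\{(f,g): |f(x)-g(x)|<\epsilon(x)\ \forall x\in B\}$, $\epsilon\in C^+(X)$; $\tau_{\mathcal{B}}^{sw}$: $\{(f,g): \exists\,\delta>0\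 \forall x\in B^\delta,\ |f(x)-g(x)|<\epsilon(x)\}$, $\epsilon\in C^+(X)$. For a topological space $Y$, the density is $d(Y)=\aleph_0+\min\{|D|: D\text{ is dense in }Y\}$. *)

theory Defs
  imports "HOL-Analysis.Analysis"
begin

unbundle cardinal_syntax

definition bornology :: "'a set set \<Rightarrow> bool" where
  "bornology \<B> \<longleftrightarrow>
     {} \<notin> \<B> \<and> \<Union>\<B> = UNIV \<and>
     (\<forall>A\<in>\<B>. \<forall>B\<in>\<B>. A \<union> B \<in> \<B>) \<and>
     (\<forall>B\<in>\<B>. \<forall>A. A \<noteq> {} \<longrightarrow> A \<subseteq> B \<longrightarrow> A \<in> \<B>)"

definition bornology_base :: "'a set set \<Rightarrow> 'a set set \<Rightarrow> bool" where
  "bornology_base \<B>\<^sub>0 \<B> \<longleftrightarrow> \<B>\<^sub>0 \<subseteq> \<B> \<and> (\<forall>B\<in>\<B>. \<exists>B'\<in>\<B>\<^sub>0. B \<subseteq> B')"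

definition has_closed_base :: "'a::topological_space set set \<Rightarrow> bool" where
  "has_closed_base \<B> \<longleftrightarrow> (\<exists>\<B>\<^sub>0. bornology_base \<B>\<^sub>0 \<B> \<and> (\<forall>B\<in>\<B>\<^sub>0. closed B))"

definition cont_funs :: "('a::topological_space \<Rightarrow> real) set" where
  "cont_funs = {f. continuous_on UNIV f}"

definition pos_cont_funs :: "('a::topological_space \<Rightarrow> real) set" where
  "pos_cont_funs = {f. continuous_on UNIV f \<and> (\<forall>x. 0 < f x)}"

definition enlargement :: "'a::metric_space set \<Rightarrow> real \<Rightarrow> 'a set" where
  "enlargement A \<delta> = (\<Union>x\<in>A. {y. dist x y < \<delta>})"

definition uniformity_base :: "'b set \<Rightarrow> ('b \<times> 'b) set set \<Rightarrow> bool" where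
  "uniformity_base S \<E> \<longleftrightarrow>
     \<E> \<noteq> {} \<and>
     (\<forall>E\<in>\<E>. Id_on S \<subseteq> E \<and> E \<subseteq> S \<times> S) \<and>
     (\<forall>E\<in>\<E>. \<forall>F\<in>\<E>. \<exists>G\<in>\<E>. G \<subseteq> E \<inter> F) \<and>
     (\<forall>E\<in>\<E>. \<exists>F\<in>\<E>. F \<subseteq> E\<inverse>) \<and>
     (\<forall>E\<in>\<E>. \<exists>F\<in>\<E>. F O F \<subseteq> E)"

text \<open>The topology induced by the uniformity with base \<open>\<E>\<close>. The predicate below is a
  topology with carrier \<open>S\<close> whenever \<open>\<E>\<close> is a uniformity base on \<open>S\<close>; this is
  so in the four instances \<open>tau\<close>, \<open>tau_s\<close>, \<open>tau_w\<close>, \<open>tau_sw\<close> (shown at the end).\<close>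

definition uniform_topology :: "'b set \<Rightarrow> ('b \<times> 'b) set set \<Rightarrow> 'b topology" where
  "uniform_topology S \<E> = topology (\<lambda>U. U \<subseteq> S \<and> (\<forall>f\<in>U. \<exists>E\<in>\<E>. E `` {f} \<subseteq> U))"

definition entourage :: "'a::metric_space set \<Rightarrow> ('a \<Rightarrow> real) \<Rightarrow> (('a \<Rightarrow> real) \<times> ('a \<Rightarrow> real)) set" where
  "entourage B \<epsilon> =
     {(f, g). f \<in> cont_funs \<and> g \<in> cont_funs \<and> (\<forall>x\<in>B. \<bar>f x - g x\<bar> < \<epsilon> x)}"

definition strong_entourage :: "'a::metric_space set \<Rightarrow> ('a \<Rightarrow> real) \<Rightarrow> (('a \<Rightarrow> real) \<times> ('a \<Rightarrow> real)) set" where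
  "strong_entourage B \<epsilon> =
     {(f, g). f \<in> cont_funs \<and> g \<in> cont_funs \<and>
        (\<exists>\<delta>>0. \<forall>x\<in>enlargement B \<delta>. \<bar>f x - g x\<bar> < \<epsilon> x)}"

definition tau :: "'a::metric_space set set \<Rightarrow> ('a \<Rightarrow> real) topology" where
  "tau \<B> = uniform_topology cont_funs {entourage B (\<lambda>_. \<epsilon>) |B \<epsilon>. B \<in> \<B> \<and> 0 < \<epsilon>}"

definition tau_s :: "'a::metric_space set set \<Rightarrow> ('a \<Rightarrow> real) topology" where
  "tau_s \<B> = uniform_topology cont_funs {strong_entourage B (\<lambda>_. \<epsilon>) |B \<epsilon>. B \<in> \<B> \<and> 0 < \<epsilon>}"

definition tau_w :: "'a::metric_space set set \<Rightarrow> ('a \<Rightarrow> real) topology" where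
  "tau_w \<B> = uniform_topology cont_funs {entourage B \<epsilon> |B \<epsilon>. B \<in> \<B> \<and> \<epsilon> \<in> pos_cont_funs}"

definition tau_sw :: "'a::metric_space set set \<Rightarrow> ('a \<Rightarrow> real) topology" where
  "tau_sw \<B> = uniform_topology cont_funs {strong_entourage B \<epsilon> |B \<epsilon>. B \<in> \<B> \<and> \<epsilon> \<in> pos_cont_funs}"

definition dense_subset :: "'b topology \<Rightarrow> 'b set \<Rightarrow> bool" where
  "dense_subset Y D \<longleftrightarrow> D \<subseteq> topspace Y \<and> Y closure_of D = topspace Y"

definition is_min_dense :: "'b topology \<Rightarrow> 'b set \<Rightarrow> bool" where
  "is_min_dense Y D \<longleftrightarrow> dense_subset Y D \<and> (\<forall>D'. dense_subset Y D' \<longrightarrow> |D| \<le>o |D'| )"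

text \<open>Cardinal numbers are well-orders taken up to \<open>=o\<close>, so the choice of \<open>D\<close>
  is immaterial; a dense set of least cardinality exists by \<open>is_min_dense_exists\<close> below.\<close>

definition density_character :: "'b topology \<Rightarrow> (nat + 'b) rel" where
  "density_character Y = natLeq +c |SOME D. is_min_dense Y D|"

lemma is_min_dense_exists: "\<exists>D. is_min_dense Y D"
proof -
  let ?R = "{ |D| | D. dense_subset Y D}"
  have "dense_subset Y (topspace Y)" by (simp add: dense_subset_def)
  then have "?R \<noteq> {}" by blast
  moreover have "\<forall>r\<in>?R. Card_order r" by (auto simp: card_of_Card_order)
  ultimately have "\<exists>r\<in>?R. \<forall>r'\<in>?R. r \<le>o r'" by (rule exists_minim_Card_order)
  then obtain D where D: "dense_subset Y D" "\<forall>r'\<in>?R. |D| \<le>o r'" by auto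
  have "|D| \<le>o |D'|" if "dense_subset Y D'" for D'
    using that by (intro bspec[OF D(2)]) auto
  with D(1) have "is_min_dense Y D" unfolding is_min_dense_def by simp
  then show ?thesis by (rule exI)
qed

lemma openin_uniform_topology:
  assumes "uniformity_base S \<E>"
  shows "openin (uniform_topology S \<E>) U \<longleftrightarrow> U \<subseteq> S \<and> (\<forall>f\<in>U. \<exists>E\<in>\<E>. E `` {f} \<subseteq> U)"
proof -
  have dir: "\<exists>G\<in>\<E>. G \<subseteq> E \<inter> F" if "E \<in> \<E>" "F \<in> \<E>" for E F
    using assms that unfolding uniformity_base_def by blast
  have "istopology (\<lambda>U. U \<subseteq> S \<and> (\<forall>f\<in>U. \<exists>E\<in>\<E>. E `` {f} \<subseteq> U))"
    unfolding istopology_def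
  proof (intro conjI allI impI ballI)
    fix U V f
    assume U: "U \<subseteq> S \<and> (\<forall>f\<in>U. \<exists>E\<in>\<E>. E `` {f} \<subseteq> U)"
      and V: "V \<subseteq> S \<and> (\<forall>f\<in>V. \<exists>E\<in>\<E>. E `` {f} \<subseteq> V)" and f: "f \<in> U \<inter> V"
    obtain E where E: "E \<in> \<E>" "E `` {f} \<subseteq> U" using U f by auto
    obtain F where F: "F \<in> \<E>" "F `` {f} \<subseteq> V" using V f by auto
    obtain G where "G \<in> \<E>" "G \<subseteq> E \<inter> F" using dir[OF E(1) F(1)] by auto
    then show "\<exists>E\<in>\<E>. E `` {f} \<subseteq> U \<inter> V" using E(2) F(2) by (intro bexI[of _ G]) auto
  next
    fix \<K> f
    assume K: "\<forall>K\<in>\<K>. K \<subseteq> S \<and> (\<forall>f\<in>K. \<exists>E\<in>\<E>. E `` {f} \<subseteq> K)" and f: "f \<in> \<Union>\<K>"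
    from f obtain K where "K \<in> \<K>" "f \<in> K" by auto
    have "\<forall>f\<in>K. \<exists>E\<in>\<E>. E `` {f} \<subseteq> K" using bspec[OF K \<open>K \<in> \<K>\<close>] by (rule conjunct2)
    from bspec[OF this \<open>f \<in> K\<close>] obtain E where "E \<in> \<E>" "E `` {f} \<subseteq> K" by (rule bexE)
    with \<open>K \<in> \<K>\<close> show "\<exists>E\<in>\<E>. E `` {f} \<subseteq> \<Union>\<K>" by (intro bexI[of _ E]) auto
  qed (simp_all add: Sup_le_iff le_infI1)
  then show ?thesis by (simp add: uniform_topology_def topology_inverse')
qed

lemma topspace_uniform_topology:
  assumes "uniformity_base S \<E>"
  shows "topspace (uniform_topology S \<E>) = S"
proof
  show "topspace (uniform_topology S \<E>) \<subseteq> S"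
    using openin_uniform_topology[OF assms, of "topspace (uniform_topology S \<E>)"] by simp
  have "openin (uniform_topology S \<E>) S"
  proof -
    obtain E where "E \<in> \<E>" "E \<subseteq> S \<times> S" using assms unfolding uniformity_base_def by fast
    then have "\<exists>E\<in>\<E>. E `` {f} \<subseteq> S" for f by (intro bexI[of _ E]) auto
    then show ?thesis unfolding openin_uniform_topology[OF assms] by simp
  qed
  then show "S \<subseteq> topspace (uniform_topology S \<E>)" by (rule openin_subset)
qed

lemma entourage_mono:
  assumes "A \<subseteq> B" and le: "\<And>x. \<epsilon> x \<le> \<eta> x"
  shows "entourage B \<epsilon> \<subseteq> entourage A \<eta>"
  using assms(1) less_le_trans[OF _ le] unfolding entourage_def by blast

lemma strong_entourage_mono:
  assumes "A \<subseteq> B" and le: "\<And>x. \<epsilon> x \<le> \<eta> x"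
  shows "strong_entourage B \<epsilon> \<subseteq> strong_entourage A \<eta>"
proof -
  have "enlargement A \<delta> \<subseteq> enlargement B \<delta>" for \<delta>
    using assms(1) unfolding enlargement_def by blast
  then show ?thesis
    using less_le_trans[OF _ le] unfolding strong_entourage_def by blast
qed

lemma entourage_half:
  "entourage B (\<lambda>x. \<epsilon> x / 2) O entourage B (\<lambda>x. \<epsilon> x / 2) \<subseteq> entourage B \<epsilon>"
proof clarify
  fix f g h
  assume fg: "(f, g) \<in> entourage B (\<lambda>x. \<epsilon> x / 2)" and gh: "(g, h) \<in> entourage B (\<lambda>x. \<epsilon> x / 2)"
  have "\<bar>f x - h x\<bar> < \<epsilon> x" if "x \<in> B" for x
  proof -
    have "\<bar>f x - g x\<bar> < \<epsilon> x / 2" "\<bar>g x - h x\<bar> < \<epsilon> x / 2"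
      using fg gh that unfolding entourage_def by auto
    then show ?thesis by linarith
  qed
  then show "(f, h) \<in> entourage B \<epsilon>" using fg gh unfolding entourage_def by blast
qed

lemma strong_entourage_half:
  "strong_entourage B (\<lambda>x. \<epsilon> x / 2) O strong_entourage B (\<lambda>x. \<epsilon> x / 2) \<subseteq> strong_entourage B \<epsilon>"
proof clarify
  fix f g h
  assume fg: "(f, g) \<in> strong_entourage B (\<lambda>x. \<epsilon> x / 2)"
    and gh: "(g, h) \<in> strong_entourage B (\<lambda>x. \<epsilon> x / 2)"
  obtain a where a: "a > 0" "\<And>x. x \<in> enlargement B a \<Longrightarrow> \<bar>f x - g x\<bar> < \<epsilon> x / 2"
    using fg unfolding strong_entourage_def by auto
  obtain b where b: "b > 0" "\<And>x. x \<in> enlargement B b \<Longrightarrow> \<bar>g x - h x\<bar> < \<epsilon> x / 2"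
    using gh unfolding strong_entourage_def by auto
  have "\<bar>f x - h x\<bar> < \<epsilon> x" if "x \<in> enlargement B (min a b)" for x
  proof -
    have "x \<in> enlargement B a" "x \<in> enlargement B b" using that unfolding enlargement_def by auto
    then have "\<bar>f x - g x\<bar> < \<epsilon> x / 2" "\<bar>g x - h x\<bar> < \<epsilon> x / 2" using a b by auto
    then show ?thesis by linarith
  qed
  moreover have "min a b > 0" using a b by simp
  ultimately show "(f, h) \<in> strong_entourage B \<epsilon>"
    using fg gh unfolding strong_entourage_def by blast
qed

lemma uniformity_base_family:
  fixes E :: "'a::metric_space set \<Rightarrow> ('a \<Rightarrow> real) \<Rightarrow> (('a \<Rightarrow> real) \<times> ('a \<Rightarrow> real)) set"
  assumes \<B>: "bornology \<B>"
    and P: "P \<noteq> {}" "\<And>\<epsilon> \<eta>. \<epsilon> \<in> P \<Longrightarrow> \<eta> \<in> P \<Longrightarrow> (\<lambda>x. min (\<epsilon> x) (\<eta> x)) \<in> P"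
      "\<And>\<epsilon>. \<epsilon> \<in> P \<Longrightarrow> (\<lambda>x. \<epsilon> x / 2) \<in> P"
    and refl: "\<And>B \<epsilon>. \<epsilon> \<in> P \<Longrightarrow> Id_on cont_funs \<subseteq> E B \<epsilon> \<and> E B \<epsilon> \<subseteq> cont_funs \<times> cont_funs"
    and mono: "\<And>A B \<epsilon> \<eta>. A \<subseteq> B \<Longrightarrow> (\<And>x. \<epsilon> x \<le> \<eta> x) \<Longrightarrow> E B \<epsilon> \<subseteq> E A \<eta>"
    and sym: "\<And>B \<epsilon>. (E B \<epsilon>)\<inverse> = E B \<epsilon>"
    and half: "\<And>B \<epsilon>. E B (\<lambda>x. \<epsilon> x / 2) O E B (\<lambda>x. \<epsilon> x / 2) \<subseteq> E B \<epsilon>"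
  shows "uniformity_base cont_funs {E B \<epsilon> |B \<epsilon>. B \<in> \<B> \<and> \<epsilon> \<in> P}"
proof -
  have "\<B> \<noteq> {}" using \<B> unfolding bornology_def by auto
  then have ne: "{E B \<epsilon> |B \<epsilon>. B \<in> \<B> \<and> \<epsilon> \<in> P} \<noteq> {}" using P(1) by auto
  have dir: "\<exists>G\<in>{E B \<epsilon> |B \<epsilon>. B \<in> \<B> \<and> \<epsilon> \<in> P}. G \<subseteq> E A \<epsilon> \<inter> E B \<eta>"
    if "A \<in> \<B>" "B \<in> \<B>" "\<epsilon> \<in> P" "\<eta> \<in> P" for A B \<epsilon> \<eta>
  proof -
    have "A \<union> B \<in> \<B>" using \<B> that unfolding bornology_def by blast
    moreover have "E (A \<union> B) (\<lambda>x. min (\<epsilon> x) (\<eta> x)) \<subseteq> E A \<epsilon> \<inter> E B \<eta>"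
      using mono[of A "A \<union> B" "\<lambda>x. min (\<epsilon> x) (\<eta> x)" \<epsilon>] mono[of B "A \<union> B" "\<lambda>x. min (\<epsilon> x) (\<eta> x)" \<eta>]
      by auto
    ultimately show ?thesis using P(2)[OF that(3,4)] by blast
  qed
  have halves: "\<exists>F\<in>{E B \<epsilon> |B \<epsilon>. B \<in> \<B> \<and> \<epsilon> \<in> P}. F O F \<subseteq> E B \<epsilon>" if "B \<in> \<B>" "\<epsilon> \<in> P" for B \<epsilon>
    using half[of B \<epsilon>] P(3)[OF that(2)] that(1) by blast
  show ?thesis
    unfolding uniformity_base_def
  proof (intro conjI ballI)
    fix F G assume "F \<in> {E B \<epsilon> |B \<epsilon>. B \<in> \<B> \<and> \<epsilon> \<in> P}" "G \<in> {E B \<epsilon> |B \<epsilon>. B \<in> \<B> \<and> \<epsilon> \<in> P}"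
    then obtain A \<epsilon> B \<eta> where FG: "F = E A \<epsilon>" "G = E B \<eta>" "A \<in> \<B>" "B \<in> \<B>" "\<epsilon> \<in> P" "\<eta> \<in> P"
      by blast
    show "\<exists>H\<in>{E B \<epsilon> |B \<epsilon>. B \<in> \<B> \<and> \<epsilon> \<in> P}. H \<subseteq> F \<inter> G"
      unfolding FG(1,2) by (rule dir[OF FG(3-6)])
  next
    fix F assume F: "F \<in> {E B \<epsilon> |B \<epsilon>. B \<in> \<B> \<and> \<epsilon> \<in> P}"
    then obtain A \<epsilon> where A: "F = E A \<epsilon>" "A \<in> \<B>" "\<epsilon> \<in> P" by blast
    show "\<exists>H\<in>{E B \<epsilon> |B \<epsilon>. B \<in> \<B> \<and> \<epsilon> \<in> P}. H \<subseteq> F\<inverse>" using F by (rule bexI[rotated]) (simp add: A(1) sym)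
    show "\<exists>H\<in>{E B \<epsilon> |B \<epsilon>. B \<in> \<B> \<and> \<epsilon> \<in> P}. H O H \<subseteq> F" unfolding A(1) by (rule halves[OF A(2,3)])
    show "Id_on cont_funs \<subseteq> F" "F \<subseteq> cont_funs \<times> cont_funs" using refl[OF A(3)] A(1) by simp_all
  qed (rule ne)
qed

lemma entourage_sym: "(entourage B \<epsilon>)\<inverse> = entourage B \<epsilon>"
  unfolding entourage_def by (auto simp: abs_minus_commute)

lemma strong_entourage_sym: "(strong_entourage B \<epsilon>)\<inverse> = strong_entourage B \<epsilon>"
  unfolding strong_entourage_def by (auto simp: abs_minus_commute)

lemma entourage_refl:
  assumes "\<And>x. 0 < \<epsilon> x"
  shows "Id_on cont_funs \<subseteq> entourage B \<epsilon> \<and> entourage B \<epsilon> \<subseteq> cont_funs \<times> cont_funs"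
  using assms unfolding entourage_def by auto

lemma strong_entourage_refl:
  assumes "\<And>x. 0 < \<epsilon> x"
  shows "Id_on cont_funs \<subseteq> strong_entourage B \<epsilon> \<and> strong_entourage B \<epsilon> \<subseteq> cont_funs \<times> cont_funs"
  using assms unfolding strong_entourage_def by (auto intro: exI[of _ 1])

lemma pos_cont_funs_closed:
  "(pos_cont_funs :: ('a::topological_space \<Rightarrow> real) set) \<noteq> {}"
  "\<epsilon> \<in> pos_cont_funs \<Longrightarrow> \<eta> \<in> pos_cont_funs \<Longrightarrow> (\<lambda>x. min (\<epsilon> x) (\<eta> x)) \<in> pos_cont_funs"
  "\<epsilon> \<in> pos_cont_funs \<Longrightarrow> (\<lambda>x. \<epsilon> x / 2) \<in> pos_cont_funs"
proof -
  have "(\<lambda>_::'a. 1::real) \<in> pos_cont_funs" by (simp add: pos_cont_funs_def)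
  then show "(pos_cont_funs :: ('a \<Rightarrow> real) set) \<noteq> {}" by blast
qed (auto simp: pos_cont_funs_def intro!: continuous_intros)

lemma const_funs_closed:
  defines "P \<equiv> (\<lambda>e _. e) ` {0::real<..}"
  shows "P \<noteq> {}"
    "\<epsilon> \<in> P \<Longrightarrow> \<eta> \<in> P \<Longrightarrow> (\<lambda>x. min (\<epsilon> x) (\<eta> x)) \<in> P"
    "\<epsilon> \<in> P \<Longrightarrow> (\<lambda>x. \<epsilon> x / 2) \<in> P"
proof -
  show "P \<noteq> {}" unfolding P_def by simp
  show "(\<lambda>x. min (\<epsilon> x) (\<eta> x)) \<in> P" if "\<epsilon> \<in> P" "\<eta> \<in> P"
  proof -
    obtain a b where "\<epsilon> = (\<lambda>_. a)" "\<eta> = (\<lambda>_. b)" "0 < a" "0 < b" using \<open>\<epsilon> \<in> P\<close> \<open>\<eta> \<in> P\<close> unfolding P_def by auto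
    then show ?thesis unfolding P_def by (intro image_eqI[of _ _ "min a b"]) auto
  qed
  show "(\<lambda>x. \<epsilon> x / 2) \<in> P" if "\<epsilon> \<in> P"
  proof -
    obtain a where "\<epsilon> = (\<lambda>_. a)" "0 < a" using \<open>\<epsilon> \<in> P\<close> unfolding P_def by auto
    then show ?thesis unfolding P_def by (intro image_eqI[of _ _ "a / 2"]) auto
  qed
qed

lemma const_entourages:
  "{E B (\<lambda>_. \<epsilon>) |B \<epsilon>. B \<in> \<B> \<and> (0::real) < \<epsilon>} = {E B \<epsilon> |B \<epsilon>. B \<in> \<B> \<and> \<epsilon> \<in> (\<lambda>e _. e) ` {0<..}}"
  by auto

lemma uniformity_base_tau:
  assumes "bornology \<B>"
  shows "uniformity_base cont_funs {entourage B (\<lambda>_. \<epsilon>) |B \<epsilon>. B \<in> \<B> \<and> 0 < \<epsilon>}"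
  unfolding const_entourages
  by (rule uniformity_base_family[where E = entourage,
        OF assms const_funs_closed entourage_refl entourage_mono entourage_sym entourage_half])
    auto

lemma uniformity_base_tau_s:
  assumes "bornology \<B>"
  shows "uniformity_base cont_funs {strong_entourage B (\<lambda>_. \<epsilon>) |B \<epsilon>. B \<in> \<B> \<and> 0 < \<epsilon>}"
  unfolding const_entourages
  by (rule uniformity_base_family[where E = strong_entourage,
        OF assms const_funs_closed strong_entourage_refl strong_entourage_mono
          strong_entourage_sym strong_entourage_half])
    auto

lemma uniformity_base_tau_w:
  assumes "bornology \<B>"
  shows "uniformity_base cont_funs {entourage B \<epsilon> |B \<epsilon>. B \<in> \<B> \<and> \<epsilon> \<in> pos_cont_funs}"
  by (rule uniformity_base_family[where E = entourage,
        OF assms pos_cont_funs_closed entourage_refl entourage_mono entourage_sym entourage_half])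
    (auto simp: pos_cont_funs_def)

lemma uniformity_base_tau_sw:
  assumes "bornology \<B>"
  shows "uniformity_base cont_funs {strong_entourage B \<epsilon> |B \<epsilon>. B \<in> \<B> \<and> \<epsilon> \<in> pos_cont_funs}"
  by (rule uniformity_base_family[where E = strong_entourage,
        OF assms pos_cont_funs_closed strong_entourage_refl strong_entourage_mono
          strong_entourage_sym strong_entourage_half])
    (auto simp: pos_cont_funs_def)

end

theory Submission
  imports Defs
begin

text \<open>
  Allowing the tolerance \<open>\<epsilon>\<close> to vary over the space refines the topology, so the density can
  only grow; the content is that it does not grow.  The idea is to code a pair consisting of a
  target function \<open>f\<close> and a positive tolerance \<open>\<epsilon>\<close> into two continuous functions \<open>p\<close> and \<open>q\<close>,
  in such a way that approximating \<open>p\<close> and \<open>q\<close> up to one \<^emph>\<open>constant\<close> error is enough to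
  recover \<open>f\<close> up to the \<^emph>\<open>varying\<close> error \<open>\<epsilon>\<close>.

  Since \<open>f = (f / \<epsilon>) \<cdot> exp (ln \<epsilon>)\<close>, it suffices to know the planar point
  \<open>z = (f / \<epsilon>, ln \<epsilon>)\<close> with an error at most a small multiple of \<open>1 / (2 + \<bar>z\<bar>)\<close>: measured
  in units of \<open>\<epsilon>\<close>, an error in the first coordinate counts once, but a small error in \<open>ln \<epsilon>\<close>
  is magnified by about \<open>\<bar>f / \<epsilon>\<bar>\<close>.  The radial map \<open>z \<mapsto> (1 + \<bar>z\<bar>) z\<close> is a homeomorphism of the plane that
  stretches distances from \<open>z\<close> by at least \<open>1 + \<bar>z\<bar> / 2\<close> (lemma \<open>radial_stretch_expands\<close>), so a
  constant error in its value becomes an error of the required size in \<open>z\<close>.  The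
  coordinates of the stretched point are \<open>p\<close> and \<open>q\<close>, and \<open>decode\<close> is the fixed continuous
  function of two real variables that undoes the coding (lemma \<open>decode_approx\<close>).

  Consequently, if \<open>D\<close> is dense for constant tolerances, then the functions
  \<open>x \<mapsto> decode (a x) (b x)\<close> with \<open>a, b \<in> D\<close> are dense for varying tolerances, and there are at
  most \<open>\<aleph>\<^sub>0 + \<bar>D\<bar>\<close> of them.  The recovery happens pointwise, so the argument is the same
  for approximation on a set of the bornology and on an enlargement of it.
\<close>

section \<open>Density in uniform and in general topologies\<close>

lemma dense_subset_uniform_topology:
  assumes U: "uniformity_base S \<E>"
  shows "dense_subset (uniform_topology S \<E>) D \<longleftrightarrow>
    D \<subseteq> S \<and> (\<forall>f\<in>S. \<forall>E\<in>\<E>. \<exists>g\<in>D. (f, g) \<in> E)"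
proof -
  have refl: "(f, f) \<in> E" if "f \<in> S" "E \<in> \<E>" for f E
    using U that unfolding uniformity_base_def by blast
  have carrier: "E `` {f} \<subseteq> S" if "E \<in> \<E>" for f E
    using U that unfolding uniformity_base_def by blast
  have half: "\<exists>F\<in>\<E>. F O F \<subseteq> E" if "E \<in> \<E>" for E
    using U that unfolding uniformity_base_def by blast
  have "f \<in> uniform_topology S \<E> closure_of D \<longleftrightarrow> (\<forall>E\<in>\<E>. \<exists>g\<in>D. (f, g) \<in> E)"
    if f: "f \<in> S" for f
  proof
    assume cl: "f \<in> uniform_topology S \<E> closure_of D"
    show "\<forall>E\<in>\<E>. \<exists>g\<in>D. (f, g) \<in> E"
    proof
      fix E assume E: "E \<in> \<E>"
      \<comment> \<open>\<open>E `` {f}\<close> need not be open; \<open>W\<close> is its interior.\<close>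
      define W where "W = {g \<in> S. \<exists>F\<in>\<E>. F `` {g} \<subseteq> E `` {f}}"
      have "openin (uniform_topology S \<E>) W"
        unfolding openin_uniform_topology[OF U]
      proof (intro conjI ballI)
        fix g assume "g \<in> W"
        then obtain F where F: "F \<in> \<E>" "F `` {g} \<subseteq> E `` {f}" unfolding W_def by blast
        obtain H where H: "H \<in> \<E>" "H O H \<subseteq> F" using half[OF F(1)] by blast
        have "H `` {g} \<subseteq> W"
        proof
          fix h assume h: "h \<in> H `` {g}"
          then have "H `` {h} \<subseteq> E `` {f}" using H(2) F(2) by blast
          then show "h \<in> W" using carrier[OF H(1)] H(1) h unfolding W_def by blast
        qed
        then show "\<exists>H\<in>\<E>. H `` {g} \<subseteq> W" using H(1) by blast
      qed (auto simp: W_def)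
      moreover have "f \<in> W" using f E unfolding W_def by blast
      ultimately obtain g where "g \<in> D" "g \<in> W"
        using cl unfolding in_closure_of by blast
      then show "\<exists>g\<in>D. (f, g) \<in> E" using refl unfolding W_def by blast
    qed
  next
    assume "\<forall>E\<in>\<E>. \<exists>g\<in>D. (f, g) \<in> E"
    then show "f \<in> uniform_topology S \<E> closure_of D"
      using f unfolding in_closure_of topspace_uniform_topology[OF U] openin_uniform_topology[OF U]
      by blast
  qed
  moreover have "uniform_topology S \<E> closure_of D \<subseteq> S"
    using closure_of_subset_topspace[of "uniform_topology S \<E>" D]
    unfolding topspace_uniform_topology[OF U] .
  ultimately show ?thesis
    unfolding dense_subset_def topspace_uniform_topology[OF U] by blast
qed

lemma density_character_mono:
  fixes Y Z :: "'b topology"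
  assumes "\<And>D. dense_subset Y D \<Longrightarrow> \<exists>D'. dense_subset Z D' \<and> |D'| \<le>o natLeq +c |D|"
  shows "density_character Z \<le>o density_character Y"
proof -
  define D where "D = (SOME D. is_min_dense Y D)"
  define M where "M = (SOME D. is_min_dense Z D)"
  have D: "is_min_dense Y D" unfolding D_def by (rule someI_ex[OF is_min_dense_exists])
  have M: "is_min_dense Z M" unfolding M_def by (rule someI_ex[OF is_min_dense_exists])
  obtain D' where D': "dense_subset Z D'" "|D'| \<le>o natLeq +c |D|"
    using assms D unfolding is_min_dense_def by blast
  have "|M| \<le>o |D'|" using M D'(1) unfolding is_min_dense_def by blast
  then have M_le: "|M| \<le>o natLeq +c |D|" using D'(2) by (rule ordLeq_transitive)
  have inf: "Cinfinite (natLeq +c |D| )"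
    by (rule Cinfinite_csum1) (rule natLeq_Cinfinite)
  have "natLeq +c |M| \<le>o natLeq +c |D|"
    by (rule csum_cinfinite_bound[OF _ M_le natLeq_Card_order card_of_Card_order inf])
      (rule ordLeq_csum1[OF natLeq_Card_order])
  then show ?thesis unfolding density_character_def D_def M_def .
qed

lemma card_of_Times_self_ordLeq: "|D \<times> D| \<le>o natLeq +c |D|"
proof (cases "finite D")
  case True
  then have "|D \<times> D| \<le>o natLeq"
    by (intro ordLess_imp_ordLeq) (simp flip: finite_iff_ordLess_natLeq)
  then show ?thesis by (rule ordLeq_transitive) (rule ordLeq_csum1[OF natLeq_Card_order])
next
  case False
  then have "|D \<times> D| \<le>o |D|"
    by (intro ordIso_imp_ordLeq card_of_Times_same_infinite)
  then show ?thesis by (rule ordLeq_transitive) (rule ordLeq_csum2[OF card_of_Card_order])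
qed

section \<open>Coding a function together with a tolerance\<close>

definition radial_stretch :: "'v::real_normed_vector \<Rightarrow> 'v" where
  "radial_stretch z = (1 + norm z) *\<^sub>R z"

text \<open>The inverse of \<open>radial_stretch\<close>: the norms \<open>\<rho>\<close> and \<open>r\<close> of a stretched and an original
  vector are related by \<open>\<rho> = r + r\<^sup>2\<close>, that is \<open>1 + r = (1 + sqrt (1 + 4 \<rho>)) / 2\<close>.\<close>

definition radial_shrink :: "'v::real_normed_vector \<Rightarrow> 'v" where
  "radial_shrink w = (2 / (1 + sqrt (1 + 4 * norm w))) *\<^sub>R w"

lemma radial_stretch_shrink: "radial_stretch (radial_shrink w) = w"
proof -
  define s where "s = sqrt (1 + 4 * norm w)"
  have s: "s \<ge> 0" "s * s = 1 + 4 * norm w" unfolding s_def by simp_all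
  have nz: "norm (radial_shrink w) = 2 / (1 + s) * norm w"
    using s(1) unfolding radial_shrink_def s_def[symmetric] by simp
  have w: "norm w = (s * s - 1) / 4" using s(2) by simp
  have "1 + norm (radial_shrink w) = (1 + s) / 2"
    unfolding nz w using s(1) by (simp add: field_simps)
  then have "radial_stretch (radial_shrink w) = ((1 + s) / 2) *\<^sub>R radial_shrink w"
    unfolding radial_stretch_def by (rule arg_cong)
  moreover have "(1 + s) / 2 * (2 / (1 + s)) = 1" using s(1) by (simp add: field_simps)
  ultimately show ?thesis
    unfolding radial_shrink_def s_def[symmetric] by (simp only: scaleR_scaleR scaleR_one)
qed

lemma continuous_on_radial_shrink: "continuous_on A radial_shrink"
proof -
  have "1 + sqrt (1 + 4 * norm w) \<noteq> 0" for w :: 'a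
  proof -
    have "sqrt (1 + 4 * norm w) \<ge> 0" by simp
    then show ?thesis by linarith
  qed
  then show ?thesis unfolding radial_shrink_def by (intro continuous_intros) auto
qed

text \<open>With \<open>a = 1 + \<bar>u\<bar>\<close> and \<open>b = 1 + \<bar>v\<bar>\<close> one has
  \<open>2 (a u - b v) \<bullet> (u - v) = (a + b) \<bar>u - v\<bar>\<^sup>2 + (a - b) (\<bar>u\<bar>\<^sup>2 - \<bar>v\<bar>\<^sup>2)\<close>; the last
  summand is nonnegative because the stretching factor increases with the norm.  By
  Cauchy-Schwarz, distances grow at least by the factor \<open>(a + b) / 2\<close>.\<close>

lemma radial_stretch_expands:
  fixes u v :: "'v::real_inner"
  shows "(2 + norm u) * norm (u - v) \<le> 2 * norm (radial_stretch u - radial_stretch v)"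
proof (cases "u = v")
  case False
  define a b where "a = 1 + norm u" and "b = 1 + norm v"
  define d where "d = radial_stretch u - radial_stretch v"
  have "2 * (d \<bullet> (u - v)) = (a + b) * (norm (u - v))\<^sup>2 + (a - b) * ((norm u)\<^sup>2 - (norm v)\<^sup>2)"
    unfolding d_def radial_stretch_def a_def[symmetric] b_def[symmetric] power2_norm_eq_inner
    by (simp add: inner_diff_left inner_diff_right inner_commute algebra_simps)
  also have "(a - b) * ((norm u)\<^sup>2 - (norm v)\<^sup>2) = (norm u - norm v)\<^sup>2 * (norm u + norm v)"
    unfolding a_def b_def by (simp add: power2_eq_square algebra_simps)
  finally have "(a + b) * (norm (u - v))\<^sup>2 \<le> 2 * (d \<bullet> (u - v))" by simp
  also have "\<dots> \<le> 2 * (norm d * norm (u - v))" using norm_cauchy_schwarz[of d "u - v"] by simp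
  finally have "(a + b) * norm (u - v) * norm (u - v) \<le> 2 * norm d * norm (u - v)"
    by (simp add: power2_eq_square mult.assoc)
  then have "(a + b) * norm (u - v) \<le> 2 * norm d" using False by simp
  moreover have "(2 + norm u) * norm (u - v) \<le> (a + b) * norm (u - v)"
    unfolding a_def b_def by (intro mult_right_mono) auto
  ultimately show ?thesis unfolding d_def by linarith
qed simp

definition encode :: "real \<Rightarrow> real \<Rightarrow> real \<times> real" where
  "encode y e = radial_stretch (y / e, ln e)"

definition decode :: "real \<Rightarrow> real \<Rightarrow> real" where
  "decode a b = fst (radial_shrink (a, b)) * exp (snd (radial_shrink (a, b)))"

text \<open>If \<open>(t, s)\<close> is the coded point and \<open>(t', s')\<close> the recovered one, then
  \<open>t' exp s' - y = e (t' (exp (s' - s) - 1) + (t' - t))\<close>.  An error below \<open>1/10\<close> in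
  the code gives \<open>\<bar>t' - t\<bar> < 1/10\<close> and \<open>\<bar>s' - s\<bar> < 1 / (5 (2 + \<bar>t\<bar>))\<close>, which makes the
  bracket less than \<open>1/2\<close>.\<close>

lemma decode_approx:
  assumes e: "0 < e"
    and a: "\<bar>fst (encode y e) - a\<bar> < 1 / 20" and b: "\<bar>snd (encode y e) - b\<bar> < 1 / 20"
  shows "\<bar>y - decode a b\<bar> < e"
proof -
  define t s where "t = y / e" and "s = ln e"
  define t' s' where "t' = fst (radial_shrink (a, b))" and "s' = snd (radial_shrink (a, b))"
  have z': "radial_shrink (a, b) = (t', s')" unfolding t'_def s'_def by simp
  define n where "n = norm ((t, s) - (t', s'))"
  have "norm (encode y e - (a, b)) \<le> \<bar>fst (encode y e) - a\<bar> + \<bar>snd (encode y e) - b\<bar>"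
    using norm_Pair_le[of "fst (encode y e) - a" "snd (encode y e) - b"]
    by (cases "encode y e") simp
  then have "norm (radial_stretch (t, s) - radial_stretch (t', s')) < 1 / 10"
    using a b unfolding z'[symmetric] radial_stretch_shrink encode_def t_def s_def by linarith
  then have n: "(2 + norm (t, s)) * n < 1 / 5"
    using radial_stretch_expands[of "(t, s)" "(t', s')"] unfolding n_def by linarith
  have "0 \<le> n" unfolding n_def by simp
  have "\<bar>t\<bar> \<le> norm (t, s)" using norm_fst_le[of t s] by simp
  then have "(2 + \<bar>t\<bar>) * n \<le> (2 + norm (t, s)) * n"
    using \<open>0 \<le> n\<close> by (intro mult_right_mono) auto
  with n have tn: "2 * n + \<bar>t\<bar> * n < 1 / 5" by (simp add: distrib_right)
  moreover have "0 \<le> \<bar>t\<bar> * n" using \<open>0 \<le> n\<close> by simp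
  ultimately have n_less: "n < 1 / 10" by linarith
  have t: "\<bar>t' - t\<bar> \<le> n" unfolding n_def using norm_fst_le[of "t - t'" "s - s'"] by simp
  have s: "\<bar>s' - s\<bar> \<le> n" unfolding n_def using norm_snd_le[of "s - s'" "t - t'"] by simp
  define d where "d = s' - s"
  have "exp d \<le> 1 + 2 * \<bar>d\<bar>"
    using exp_bound_lemma[of d] s n_less unfolding d_def by simp
  moreover have "1 - \<bar>d\<bar> \<le> exp d"
    using exp_ge_add_one_self[of d] by linarith
  ultimately have ex: "\<bar>exp d - 1\<bar> \<le> 2 * n" using s unfolding d_def[symmetric] by linarith
  have "\<bar>t'\<bar> \<le> \<bar>t\<bar> + 1" using t n_less by linarith
  then have "\<bar>t'\<bar> * \<bar>exp d - 1\<bar> \<le> (\<bar>t\<bar> + 1) * (2 * n)"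
    using ex by (intro mult_mono) auto
  then have prod: "\<bar>t' * (exp d - 1)\<bar> \<le> 2 * (\<bar>t\<bar> * n) + 2 * n"
    unfolding abs_mult by (simp add: distrib_left distrib_right mult.left_commute)
  have "\<bar>t' * (exp d - 1) + (t' - t)\<bar> < 1"
    using prod t tn n_less \<open>0 \<le> n\<close> by linarith
  moreover have "decode a b - y = e * (t' * (exp d - 1) + (t' - t))"
  proof -
    have "e * exp d = exp s'" using e by (simp add: d_def s_def exp_diff)
    then have "e * (t' * exp d) = decode a b"
      unfolding decode_def t'_def[symmetric] s'_def[symmetric] by (simp add: mult.left_commute)
    moreover have "e * t = y" using e by (simp add: t_def)
    ultimately show ?thesis by (simp add: algebra_simps)
  qed
  ultimately have "\<bar>decode a b - y\<bar> < e * 1"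
    using e by (simp only: abs_mult abs_of_pos mult_strict_left_mono)
  then show ?thesis by (simp add: abs_minus_commute)
qed

lemma continuous_decode:
  assumes "a \<in> cont_funs" "b \<in> cont_funs"
  shows "(\<lambda>x. decode (a x) (b x)) \<in> cont_funs"
proof -
  have "continuous_on UNIV (\<lambda>x. radial_shrink (a x, b x))"
    using assms unfolding cont_funs_def
    by (intro continuous_on_compose2[OF continuous_on_radial_shrink[of UNIV]] continuous_on_Pair) auto
  then show ?thesis unfolding decode_def cont_funs_def by (auto intro!: continuous_intros)
qed

lemma continuous_encode:
  assumes "f \<in> cont_funs" "\<epsilon> \<in> pos_cont_funs"
  shows "(\<lambda>x. fst (encode (f x) (\<epsilon> x))) \<in> cont_funs"
    and "(\<lambda>x. snd (encode (f x) (\<epsilon> x))) \<in> cont_funs"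
proof -
  have f: "continuous_on UNIV f" and e: "continuous_on UNIV \<epsilon>" and ne: "\<And>x. \<epsilon> x \<noteq> 0"
    using assms by (auto simp: cont_funs_def pos_cont_funs_def less_imp_neq[symmetric] dest: spec)
  have "continuous_on UNIV (\<lambda>x. encode (f x) (\<epsilon> x))"
    unfolding encode_def radial_stretch_def by (intro continuous_intros f e) (auto simp: ne)
  then show "(\<lambda>x. fst (encode (f x) (\<epsilon> x))) \<in> cont_funs"
    and "(\<lambda>x. snd (encode (f x) (\<epsilon> x))) \<in> cont_funs"
    unfolding cont_funs_def by (auto intro: continuous_on_fst continuous_on_snd)
qed

section \<open>Constant against varying tolerances\<close>

text \<open>The hypothesis \<open>pointwise\<close> is what the two kinds of entourages share: whenever an estimate
  holds at each point where two given ones hold, membership in the entourages is inherited.\<close>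

lemma density_constant_eq_varying:
  fixes \<B> :: "'a::metric_space set set"
    and E :: "'a set \<Rightarrow> ('a \<Rightarrow> real) \<Rightarrow> (('a \<Rightarrow> real) \<times> ('a \<Rightarrow> real)) set"
  defines "\<C> \<equiv> {E B (\<lambda>_. \<epsilon>) |B \<epsilon>. B \<in> \<B> \<and> 0 < \<epsilon>}"
    and "\<V> \<equiv> {E B \<epsilon> |B \<epsilon>. B \<in> \<B> \<and> \<epsilon> \<in> pos_cont_funs}"
  assumes C: "uniformity_base cont_funs \<C>" and V: "uniformity_base cont_funs \<V>"
    and pointwise: "\<And>B c p q a b f g \<epsilon>. (p, a) \<in> E B c \<Longrightarrow> (q, b) \<in> E B c \<Longrightarrow>
      f \<in> cont_funs \<Longrightarrow> g \<in> cont_funs \<Longrightarrow>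
      (\<And>x. \<bar>p x - a x\<bar> < c x \<Longrightarrow> \<bar>q x - b x\<bar> < c x \<Longrightarrow> \<bar>f x - g x\<bar> < \<epsilon> x) \<Longrightarrow> (f, g) \<in> E B \<epsilon>"
  shows "density_character (uniform_topology cont_funs \<C>) =o
    density_character (uniform_topology cont_funs \<V>)"
proof -
  have "(\<lambda>_. \<epsilon>) \<in> (pos_cont_funs :: ('a \<Rightarrow> real) set)" if "0 < \<epsilon>" for \<epsilon>
    using that by (simp add: pos_cont_funs_def)
  then have "\<C> \<subseteq> \<V>" unfolding \<C>_def \<V>_def by blast
  then have coarser: "dense_subset (uniform_topology cont_funs \<C>) D"
    if "dense_subset (uniform_topology cont_funs \<V>) D" for D
    using that unfolding dense_subset_uniform_topology[OF C] dense_subset_uniform_topology[OF V]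
    by blast
  have "density_character (uniform_topology cont_funs \<C>) \<le>o
    density_character (uniform_topology cont_funs \<V>)"
  proof (rule density_character_mono)
    fix D assume "dense_subset (uniform_topology cont_funs \<V>) D"
    moreover have "|D| \<le>o natLeq +c |D|" by (rule ordLeq_csum2[OF card_of_Card_order])
    ultimately show "\<exists>D'. dense_subset (uniform_topology cont_funs \<C>) D' \<and> |D'| \<le>o natLeq +c |D|"
      using coarser by blast
  qed
  moreover have "density_character (uniform_topology cont_funs \<V>) \<le>o
    density_character (uniform_topology cont_funs \<C>)"
  proof (rule density_character_mono)
    fix D assume "dense_subset (uniform_topology cont_funs \<C>) D"
    then have D: "D \<subseteq> cont_funs"
      and approx: "\<And>f F. f \<in> cont_funs \<Longrightarrow> F \<in> \<C> \<Longrightarrow> \<exists>g\<in>D. (f, g) \<in> F"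
      unfolding dense_subset_uniform_topology[OF C] by blast+
    define D' where "D' = (\<lambda>(a, b) x. decode (a x) (b x)) ` (D \<times> D)"
    have "\<exists>g\<in>D'. (f, g) \<in> F" if f: "f \<in> cont_funs" and F: "F \<in> \<V>" for f F
    proof -
      obtain B \<epsilon> where B: "F = E B \<epsilon>" "B \<in> \<B>" and e: "\<epsilon> \<in> pos_cont_funs"
        using F unfolding \<V>_def by blast
      define p q where "p = (\<lambda>x. fst (encode (f x) (\<epsilon> x)))"
        and "q = (\<lambda>x. snd (encode (f x) (\<epsilon> x)))"
      have "E B (\<lambda>_. 1 / 20) \<in> \<C>"
        unfolding \<C>_def using B(2) by (auto intro!: exI[of _ B] exI[of _ "1 / 20"])
      moreover have "p \<in> cont_funs" "q \<in> cont_funs"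
        unfolding p_def q_def by (rule continuous_encode[OF f e])+
      ultimately obtain a b where ab: "a \<in> D" "(p, a) \<in> E B (\<lambda>_. 1 / 20)"
        "b \<in> D" "(q, b) \<in> E B (\<lambda>_. 1 / 20)"
        using approx by meson
      have "(f, \<lambda>x. decode (a x) (b x)) \<in> E B \<epsilon>"
      proof (rule pointwise[OF ab(2,4) f])
        show "(\<lambda>x. decode (a x) (b x)) \<in> cont_funs" using ab D by (intro continuous_decode) auto
        show "\<bar>f x - decode (a x) (b x)\<bar> < \<epsilon> x"
          if "\<bar>p x - a x\<bar> < 1 / 20" "\<bar>q x - b x\<bar> < 1 / 20" for x
          using e that unfolding p_def q_def pos_cont_funs_def by (intro decode_approx) auto
      qed
      moreover have "(\<lambda>x. decode (a x) (b x)) \<in> D'" unfolding D'_def using ab by force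
      ultimately show ?thesis using B(1) by blast
    qed
    moreover have "D' \<subseteq> cont_funs" unfolding D'_def using D by (auto intro: continuous_decode)
    ultimately have "dense_subset (uniform_topology cont_funs \<V>) D'"
      unfolding dense_subset_uniform_topology[OF V] by blast
    moreover have "|D'| \<le>o natLeq +c |D|"
      unfolding D'_def by (rule ordLeq_transitive[OF card_of_image card_of_Times_self_ordLeq])
    ultimately show "\<exists>D'. dense_subset (uniform_topology cont_funs \<V>) D' \<and> |D'| \<le>o natLeq +c |D|"
      by blast
  qed
  ultimately show ?thesis unfolding ordIso_iff_ordLeq by blast
qed

lemma entourage_pointwise:
  assumes "(p, a) \<in> entourage B c" "(q, b) \<in> entourage B c" "f \<in> cont_funs" "g \<in> cont_funs"
    and "\<And>x. \<bar>p x - a x\<bar> < c x \<Longrightarrow> \<bar>q x - b x\<bar> < c x \<Longrightarrow> \<bar>f x - g x\<bar> < \<epsilon> x"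
  shows "(f, g) \<in> entourage B \<epsilon>"
  using assms unfolding entourage_def by blast

lemma strong_entourage_pointwise:
  assumes pa: "(p, a) \<in> strong_entourage B c" and qb: "(q, b) \<in> strong_entourage B c"
    and fg: "f \<in> cont_funs" "g \<in> cont_funs"
    and imp: "\<And>x. \<bar>p x - a x\<bar> < c x \<Longrightarrow> \<bar>q x - b x\<bar> < c x \<Longrightarrow> \<bar>f x - g x\<bar> < \<epsilon> x"
  shows "(f, g) \<in> strong_entourage B \<epsilon>"
proof -
  obtain \<gamma> \<delta> where \<gamma>: "\<gamma> > 0" "\<forall>x\<in>enlargement B \<gamma>. \<bar>p x - a x\<bar> < c x"
    and \<delta>: "\<delta> > 0" "\<forall>x\<in>enlargement B \<delta>. \<bar>q x - b x\<bar> < c x"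
    using pa qb unfolding strong_entourage_def by blast
  have "enlargement B (min \<gamma> \<delta>) \<subseteq> enlargement B \<gamma> \<inter> enlargement B \<delta>"
    unfolding enlargement_def by auto
  then have "\<forall>x\<in>enlargement B (min \<gamma> \<delta>). \<bar>f x - g x\<bar> < \<epsilon> x" using imp \<gamma>(2) \<delta>(2) by blast
  moreover have "min \<gamma> \<delta> > 0" using \<gamma>(1) \<delta>(1) by simp
  ultimately show ?thesis using fg unfolding strong_entourage_def by blast
qed

theorem theorem5p5:
  fixes \<B> :: "'a::metric_space set set"
  assumes "\<exists>x y :: 'a. x \<noteq> y"
    and "bornology \<B>"
    and "has_closed_base \<B>"
  shows "density_character (tau_s \<B>) =o density_character (tau_sw \<B>) \<and>
         density_character (tau \<B>) =o density_character (tau_w \<B>)"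
proof
  show "density_character (tau_s \<B>) =o density_character (tau_sw \<B>)"
    unfolding tau_s_def tau_sw_def
    by (rule density_constant_eq_varying[where E = strong_entourage,
          OF uniformity_base_tau_s[OF assms(2)] uniformity_base_tau_sw[OF assms(2)]])
      (rule strong_entourage_pointwise)
  show "density_character (tau \<B>) =o density_character (tau_w \<B>)"
    unfolding tau_def tau_w_def
    by (rule density_constant_eq_varying[where E = entourage,
          OF uniformity_base_tau[OF assms(2)] uniformity_base_tau_w[OF assms(2)]])
      (rule entourage_pointwise)
qed

end
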